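(* Let $\mathcal{A}$ be a real tensor of order $m$ and dimension $n$. If all diagonal entries of $\mathcal{A}$ are nonnegative and $\mathcal{A}$ is diagonally dominant, then $\mathcal{A}$ is a semi-positive tensor ($\mathbf{E_0}$-tensor).
   Context: A real tensor of order $m$ ($m\ge 2$) and dimension $n$ is an array $\mathcal{A}=(a_{i_1\ldots i_m})$ with $a_{i_1\ldots i_m}\in\mathbb{R}$, $i_1,\ldots,i_m\in I_n=\{1,\ldots,n\}$; its diagonal entries are $a_{ii\ldots i}$, $i\in I_n$. For $\mathbf{x}\in\mathbb{R}^n$, $\mathcal{A}\mathbf{x}^{m-1}\in\mathbb{R}^n$ is defined by $(\mathcal{A}\mathbf{x}^{m-1})_i=\sum_{i_2,\ldots,i_m=1}^n a_{i i_2\ldots i_m}x_{i_2}\cdots x_{i_m}$. Vector inequalities are componentwise. $\mathcal{A}$ is diagonally dominant if $|a_{ii\ldots i}|\ge\sum_{(i_2,\ldots,i_m)\ne(i,\ldots,i)}|a_{ii_2\ldots i_m}|$ for all $i\in I_n$. $\mathcal{A}$ is semi-positive ($\mathbf{E_0}$-tensor) if for each $\mathbf{x}\ge\mathbf{0}$, $\mathbf{x}\ne\mathbf{0}$, there is $k\in I_n$ with $x_k>0$ and $(\mathcal{A}\mathbf{x}^{m-1})_k\ge 0$. *)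

theory Defs
  imports "HOL-Analysis.Analysis"
begin

text \<open>
  The index set \<open>I\<^sub>n\<close> is a finite type \<open>'n\<close>, so \<open>n = CARD('n)\<close>.
  A real tensor of order \<open>m\<close> and dimension \<open>n\<close> is a function on index lists. Only its values on
  lists of length \<open>m\<close> are entries of the tensor; for \<open>m \<ge> 1\<close> the definitions below
  never look at any other value. The order \<open>m\<close> is therefore passed explicitly.
\<close>

type_synonym 'n tensor = "'n list \<Rightarrow> real"

definition diag_entry :: "nat \<Rightarrow> 'n tensor \<Rightarrow> 'n \<Rightarrow> real" where
  "diag_entry m A i = A (replicate m i)"

text \<open>The vector \<open>\<A>x\<^sup>m\<^sup>-\<^sup>1\<close>; the list \<open>js\<close> is \<open>(i\<^sub>2, \<dots>, i\<^sub>m)\<close>.\<close>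

definition tensor_apply :: "nat \<Rightarrow> 'n::finite tensor \<Rightarrow> real ^ 'n \<Rightarrow> real ^ 'n" where
  "tensor_apply m A x =
     (\<chi> i. \<Sum>js | length js = m - 1. A (i # js) * (\<Prod>j\<leftarrow>js. x $ j))"

definition diagonally_dominant :: "nat \<Rightarrow> 'n::finite tensor \<Rightarrow> bool" where
  "diagonally_dominant m A \<longleftrightarrow>
     (\<forall>i. \<bar>diag_entry m A i\<bar> \<ge>
        (\<Sum>js | length js = m - 1 \<and> js \<noteq> replicate (m - 1) i. \<bar>A (i # js)\<bar>))"

text \<open>The order on \<open>real ^ 'n\<close> is the componentwise one.\<close>

definition semi_positive :: "nat \<Rightarrow> 'n::finite tensor \<Rightarrow> bool" where
  "semi_positive m A \<longleftrightarrow>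
     (\<forall>x::real ^ 'n. x \<ge> 0 \<and> x \<noteq> 0 \<longrightarrow>
        (\<exists>k. x $ k > 0 \<and> tensor_apply m A x $ k \<ge> 0))"

text \<open>The sums above range over finite sets, so none of them is zero by convention.\<close>

lemma finite_index_lists [simp]:
  "finite {js :: 'n::finite list. length js = k}"
  "finite {js :: 'n::finite list. length js = k \<and> P js}"
proof -
  show *: "finite {js :: 'n list. length js = k}"
    using finite_lists_length_eq[of "UNIV :: 'n set" k] by simp
  show "finite {js :: 'n list. length js = k \<and> P js}"
    by (rule finite_subset[OF _ *]) auto
qed

end

theory Submission
  imports Defs
begin

text \<open>
  Let \<open>x\<^sub>k\<close> be the largest component of a nonzero vector \<open>x \<ge> 0\<close>, so \<open>x\<^sub>k > 0\<close>. Every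
  monomial of degree \<open>m - 1\<close> in the components of \<open>x\<close> lies between \<open>0\<close> and
  \<open>x\<^sub>k\<^sup>m\<^sup>-\<^sup>1\<close>, and the diagonal entry multiplies exactly \<open>x\<^sub>k\<^sup>m\<^sup>-\<^sup>1\<close>. Hence
  the \<open>k\<close>-th component of \<open>\<A>x\<^sup>m\<^sup>-\<^sup>1\<close> is at least \<open>x\<^sub>k\<^sup>m\<^sup>-\<^sup>1\<close> times the diagonal entry
  minus the sum of the absolute values of the off-diagonal entries in row \<open>k\<close>. By diagonal
  dominance and the sign of the diagonal entry, this is nonnegative.
\<close>

lemma prod_list_bounds:
  fixes f :: "'a \<Rightarrow> 'b::linordered_semidom"
  assumes "\<And>j. j \<in> set js \<Longrightarrow> 0 \<le> f j \<and> f j \<le> M"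
  shows "0 \<le> (\<Prod>j\<leftarrow>js. f j) \<and> (\<Prod>j\<leftarrow>js. f j) \<le> M ^ length js"
  using assms
proof (induction js)
  case Nil
  show ?case by simp
next
  case (Cons a js)
  have "0 \<le> f a" "f a \<le> M" "0 \<le> (\<Prod>j\<leftarrow>js. f j)" "(\<Prod>j\<leftarrow>js. f j) \<le> M ^ length js"
    using Cons by auto
  then show ?case
    by (auto intro!: mult_mono)
qed

lemma exists_positive_max_component:
  fixes x :: "real ^ 'n::finite"
  assumes "x \<ge> 0" and "x \<noteq> 0"
  obtains k where "x $ k > 0" and "\<And>j. x $ j \<le> x $ k"
proof -
  obtain i where "x $ i \<noteq> 0"
    using assms(2) by (auto simp: vec_eq_iff)
  then have i: "x $ i > 0"
    using assms(1) by (auto simp: less_eq_vec_def order_less_le)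
  have "Max (range (($) x)) \<in> range (($) x)"
    by (rule Max_in) auto
  then obtain k where k: "x $ k = Max (range (($) x))"
    by (metis rangeE)
  have "x $ j \<le> x $ k" for j
    unfolding k by (rule Max_ge) auto
  with i show thesis
    by (meson less_le_trans that)
qed

theorem theorem2:
  fixes A :: "'n::finite tensor" and m :: nat
  assumes "m \<ge> 2"
    and "\<And>i. diag_entry m A i \<ge> 0"
    and "diagonally_dominant m A"
  shows "semi_positive m A"
  unfolding semi_positive_def
proof (intro allI impI, elim conjE)
  fix x :: "real ^ 'n"
  assume x: "x \<ge> 0" "x \<noteq> 0"
  obtain k where k: "x $ k > 0" "\<And>j. x $ j \<le> x $ k"
    using exists_positive_max_component[OF x] by blast
  let ?d = "replicate (m - 1) k"
  let ?off = "{js. length js = m - 1 \<and> js \<noteq> ?d}"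
  let ?M = "(x $ k) ^ (m - 1)"
  let ?term = "\<lambda>js. A (k # js) * (\<Prod>j\<leftarrow>js. x $ j)"
  have diag: "diag_entry m A k = A (k # ?d)"
    using assms(1) by (cases m) (auto simp: diag_entry_def)
  have term_lower: "- (\<bar>A (k # js)\<bar> * ?M) \<le> ?term js" if "length js = m - 1" for js
  proof -
    have "0 \<le> (\<Prod>j\<leftarrow>js. x $ j)" "(\<Prod>j\<leftarrow>js. x $ j) \<le> ?M"
      using prod_list_bounds[of js "($) x" "x $ k"] x(1) k(2) that
      by (auto simp: less_eq_vec_def)
    then have "\<bar>?term js\<bar> \<le> \<bar>A (k # js)\<bar> * ?M"
      by (simp add: abs_mult mult_left_mono)
    then show ?thesis by linarith
  qed
  have row: "{js. length js = m - 1} = insert ?d ?off"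
    by auto
  have "(\<Sum>js\<in>?off. \<bar>A (k # js)\<bar>) \<le> A (k # ?d)"
    using assms(2)[of k] assms(3) unfolding diagonally_dominant_def
    by (metis abs_of_nonneg diag)
  then have "(\<Sum>js\<in>?off. \<bar>A (k # js)\<bar>) * ?M \<le> A (k # ?d) * ?M"
    using k(1) by (intro mult_right_mono) auto
  moreover have "- ((\<Sum>js\<in>?off. \<bar>A (k # js)\<bar>) * ?M) \<le> (\<Sum>js\<in>?off. ?term js)"
    unfolding sum_distrib_right sum_negf[symmetric]
    by (intro sum_mono term_lower) auto
  moreover have "tensor_apply m A x $ k = A (k # ?d) * ?M + (\<Sum>js\<in>?off. ?term js)"
    unfolding tensor_apply_def row by (simp add: sum.insert map_replicate prod_list_replicate)
  ultimately have "tensor_apply m A x $ k \<ge> 0"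
    by linarith
  with k(1) show "\<exists>k. x $ k > 0 \<and> tensor_apply m A x $ k \<ge> 0"
    by blast
qed

end
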